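(* Let $A$ be an associative algebra and let $(r_1,r_2)$ be a compatible associative Yang-Baxter solution on $A$, with $r_1=\sum r_1^{[1]}\otimes r_1^{[2]}$ and $r_2=\sum r_2^{[1]}\otimes r_2^{[2]}$ in $A\otimes A$. Define linear maps $T_1,T_2:A\to A$ by $$T_1(a)=\sum r_1^{[1]}\cdot a\cdot r_1^{[2]},\qquad T_2(a)=\sum r_2^{[1]}\cdot a\cdot r_2^{[2]},\qquad a\in A.$$ Then $(T_1,T_2)$ is a compatible Rota-Baxter operator on $A$, i.e. a compatible $\mathcal{O}$-operator on the adjoint bimodule $A$ over the algebra $A$.
   Context: All vector spaces are over a field $\mathbf{k}$ of characteristic $0$. For an associative algebra $A$ and an $A$-bimodule $M$ (with product and both actions denoted $\cdot$), an $\mathcal{O}$-operator on $M$ over $A$ is a linear map $T:M\to A$ with $T(u)\cdot T(v)=T(T(u)\cdot v+u\cdot T(v))$ for all $u,v\in M$. A compatible $\mathcal{O}$-operator on $M$ over $A$ is a pair $(T_1,T_2)$ of $\mathcal{O}$-operators such that for all $u,v\in M$ $$T_1(u)\cdot T_2(v)+T_2(u)\cdot T_1(v)=T_1(T_2(u)\cdot v+u\cdot T_2(v))+T_2(T_1(u)\cdot v+u\cdot T_1(v)).$$ The adjoint bimodule is $M=A$ with actions given by multiplication. An associative Yang-Baxter solution on $A$ is an element $r=\sum r^{[1]}\otimes r^{[2]}\in A\otimes A$ satisfying (with $\widetilde r=\sum \widetilde r^{[1]}\otimes\widetilde r^{[2]}$ a second copy of $r$) $$\sum r^{[1]}\cdot\widetilde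 r^{[1]}\otimes\widetilde r^{[2]}\otimes r^{[2]}-\sum r^{[1]}\otimes r^{[2]}\cdot\widetilde r^{[1]}\otimes\widetilde r^{[2]}+\sum\widetilde r^{[1]}\otimes r^{[1]}\otimes r^{[2]}\cdot\widetilde r^{[2]}=0 .$$ A compatible associative Yang-Baxter solution on $A$ is a pair $(r_1,r_2)$ of associative Yang-Baxter solutions satisfying $$\sum r_1^{[1]}\cdot r_2^{[1]}\otimes r_2^{[2]}\otimes r_1^{[2]}+\sum r_2^{[1]}\cdot r_1^{[1]}\otimes r_1^{[2]}\otimes r_2^{[2]}-\sum r_1^{[1]}\otimes r_1^{[2]}\cdot r_2^{[1]}\otimes r_2^{[2]}-\sum r_2^{[1]}\otimes r_2^{[2]}\cdot r_1^{[1]}\otimes r_1^{[2]}$$ $$+\sum r_2^{[1]}\otimes r_1^{[1]}\otimes r_1^{[2]}\cdot r_2^{[2]}+\sum r_1^{[1]}\otimes r_2^{[1]}\otimes r_2^{[2]}\cdot r_1^{[2]}=0.$$ *)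

theory Defs
  imports Complex_Main "HOL-Library.Poly_Mapping"
begin

section \<open>Algebras, bimodules and O-operators\<close>

text \<open>The class \<open>ring\<close> does not demand a unit, so algebras here need not be unital.\<close>

locale assoc_algebra = vector_space scale
  for scale :: "'k::field_char_0 \<Rightarrow> 'a::ring \<Rightarrow> 'a" +
  assumes scale_mult_left: "scale c x * y = scale c (x * y)"
    and scale_mult_right: "x * scale c y = scale c (x * y)"

locale algebra_bimodule = assoc_algebra scale + M: vector_space scaleM
  for scale :: "'k::field_char_0 \<Rightarrow> 'a::ring \<Rightarrow> 'a"
    and scaleM :: "'k \<Rightarrow> 'm::ab_group_add \<Rightarrow> 'm"
    and lact :: "'a \<Rightarrow> 'm \<Rightarrow> 'm"
    and ract :: "'m \<Rightarrow> 'a \<Rightarrow> 'm" +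
  assumes lact_add_left: "lact (x + y) u = lact x u + lact y u"
    and lact_add_right: "lact x (u + v) = lact x u + lact x v"
    and lact_scale_left: "lact (scale c x) u = scaleM c (lact x u)"
    and lact_scale_right: "lact x (scaleM c u) = scaleM c (lact x u)"
    and ract_add_left: "ract (u + v) x = ract u x + ract v x"
    and ract_add_right: "ract u (x + y) = ract u x + ract u y"
    and ract_scale_left: "ract (scaleM c u) x = scaleM c (ract u x)"
    and ract_scale_right: "ract u (scale c x) = scaleM c (ract u x)"
    and lact_mult: "lact (x * y) u = lact x (lact y u)"
    and ract_mult: "ract u (x * y) = ract (ract u x) y"
    and lact_ract: "ract (lact x u) y = lact x (ract u y)"

lemma (in assoc_algebra) adjoint_bimodule: "algebra_bimodule scale scale (*) (*)"
  by unfold_locales (simp_all add: distrib_left distrib_right scale_mult_left scale_mult_right mult.assoc)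

locale O_operator = algebra_bimodule scale scaleM lact ract
  for scale :: "'k::field_char_0 \<Rightarrow> 'a::ring \<Rightarrow> 'a"
    and scaleM :: "'k \<Rightarrow> 'm::ab_group_add \<Rightarrow> 'm"
    and lact :: "'a \<Rightarrow> 'm \<Rightarrow> 'm"
    and ract :: "'m \<Rightarrow> 'a \<Rightarrow> 'm"
    and T :: "'m \<Rightarrow> 'a" +
  assumes linear_T: "Vector_Spaces.linear scaleM scale T"
    and O_identity: "T u * T v = T (lact (T u) v + ract u (T v))"

locale compatible_O_operator =
  T1: O_operator scale scaleM lact ract T1 + T2: O_operator scale scaleM lact ract T2
  for scale :: "'k::field_char_0 \<Rightarrow> 'a::ring \<Rightarrow> 'a"
    and scaleM :: "'k \<Rightarrow> 'm::ab_group_add \<Rightarrow> 'm"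
    and lact :: "'a \<Rightarrow> 'm \<Rightarrow> 'm"
    and ract :: "'m \<Rightarrow> 'a \<Rightarrow> 'm"
    and T1 T2 :: "'m \<Rightarrow> 'a" +
  assumes compatible: "T1 u * T2 v + T2 u * T1 v =
    T1 (lact (T2 u) v + ract u (T2 v)) + T2 (lact (T1 u) v + ract u (T1 v))"

definition compatible_Rota_Baxter_operator ::
    "('k::field_char_0 \<Rightarrow> 'a::ring \<Rightarrow> 'a) \<Rightarrow> ('a \<Rightarrow> 'a) \<Rightarrow> ('a \<Rightarrow> 'a) \<Rightarrow> bool" where
  "compatible_Rota_Baxter_operator scale T1 T2 \<longleftrightarrow>
     compatible_O_operator scale scale (*) (*) T1 T2"


section \<open>Free vector spaces\<close>

text \<open>The type \<open>'x \<Rightarrow>\<^sub>0 'k\<close> is the \<open>'k\<close>-vector space with basis \<open>'x\<close>.\<close>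

definition fscale :: "'k::field \<Rightarrow> ('x \<Rightarrow>\<^sub>0 'k) \<Rightarrow> ('x \<Rightarrow>\<^sub>0 'k)" where
  "fscale c p = Poly_Mapping.map ((*) c) p"

definition fbasis :: "'x \<Rightarrow> ('x \<Rightarrow>\<^sub>0 'k::field)" where
  "fbasis x = Poly_Mapping.single x 1"

lemma lookup_fscale [simp]: "Poly_Mapping.lookup (fscale c p) x = c * Poly_Mapping.lookup p x"
  by (simp add: fscale_def map.rep_eq when_def)

global_interpretation free: vector_space "fscale :: 'k::field \<Rightarrow> ('x \<Rightarrow>\<^sub>0 'k) \<Rightarrow> ('x \<Rightarrow>\<^sub>0 'k)"
  by unfold_locales (rule poly_mapping_eqI, simp add: lookup_add algebra_simps)+

text \<open>The linear extension of a map \<open>h\<close> on the basis, with values in a space with scaling \<open>s\<close>.\<close>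

definition lin_ext :: "('k::field \<Rightarrow> 'v::ab_group_add \<Rightarrow> 'v) \<Rightarrow> ('x \<Rightarrow> 'v) \<Rightarrow> ('x \<Rightarrow>\<^sub>0 'k) \<Rightarrow> 'v" where
  "lin_ext s h p = (\<Sum>x\<in>Poly_Mapping.keys p. s (Poly_Mapping.lookup p x) (h x))"

definition bilin_ext :: "('x \<Rightarrow> 'y \<Rightarrow> 'z) \<Rightarrow> ('x \<Rightarrow>\<^sub>0 'k::field) \<Rightarrow> ('y \<Rightarrow>\<^sub>0 'k) \<Rightarrow> ('z \<Rightarrow>\<^sub>0 'k)" where
  "bilin_ext g p q = lin_ext fscale (\<lambda>x. lin_ext fscale (\<lambda>y. fbasis (g x y)) q) p"

context vector_space
begin

lemma lin_ext_superset:
  assumes "finite S" "Poly_Mapping.keys p \<subseteq> S"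
  shows "lin_ext scale h p = (\<Sum>x\<in>S. scale (Poly_Mapping.lookup p x) (h x))"
  unfolding lin_ext_def using assms
  by (intro sum.mono_neutral_left) (auto simp: in_keys_iff)

lemma lin_ext_add: "lin_ext scale h (p + q) = lin_ext scale h p + lin_ext scale h q"
proof -
  let ?S = "Poly_Mapping.keys p \<union> Poly_Mapping.keys q"
  have "Poly_Mapping.keys (p + q) \<subseteq> ?S" by (rule Poly_Mapping.keys_add)
  then show ?thesis
    by (simp add: lin_ext_superset[of ?S] lookup_add scale_left_distrib sum.distrib)
qed

lemma lin_ext_scale: "lin_ext scale h (fscale c p) = scale c (lin_ext scale h p)"
proof -
  have "Poly_Mapping.keys (fscale c p) \<subseteq> Poly_Mapping.keys p" by (auto simp: in_keys_iff)
  then show ?thesis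
    by (simp add: lin_ext_superset[of "Poly_Mapping.keys p"] scale_sum_right)
qed

lemma linear_lin_ext: "Vector_Spaces.linear fscale scale (lin_ext scale h)"
  by unfold_locales (simp_all add: lin_ext_add lin_ext_scale scale_right_distrib scale_left_distrib)

lemma lin_ext_diff: "lin_ext scale h (p - q) = lin_ext scale h p - lin_ext scale h q"
  using lin_ext_add[of h "p - q" q] by simp

lemma lin_ext_fbasis [simp]: "lin_ext scale h (fbasis x) = h x"
  by (simp add: lin_ext_def fbasis_def)

end


section \<open>The tensor products \<open>A \<otimes> A\<close> and \<open>A \<otimes> A \<otimes> A\<close>\<close>

text \<open>
  The quotients of the free vector spaces on \<open>A \<times> A\<close> and \<open>A \<times> A \<times> A\<close> by the subspaces spanned by
  the multilinearity relators. A tensor is an equivalence class of formal linear combinations.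
\<close>

definition relators2 :: "('k::field_char_0 \<Rightarrow> 'a::ring \<Rightarrow> 'a) \<Rightarrow> (('a \<times> 'a) \<Rightarrow>\<^sub>0 'k) set" where
  "relators2 scale =
     {fbasis (x + x', y) - fbasis (x, y) - fbasis (x', y) | x x' y. True} \<union>
     {fbasis (x, y + y') - fbasis (x, y) - fbasis (x, y') | x y y'. True} \<union>
     {fbasis (scale c x, y) - fscale c (fbasis (x, y)) | c x y. True} \<union>
     {fbasis (x, scale c y) - fscale c (fbasis (x, y)) | c x y. True}"

definition relators3 :: "('k::field_char_0 \<Rightarrow> 'a::ring \<Rightarrow> 'a) \<Rightarrow> (('a \<times> 'a \<times> 'a) \<Rightarrow>\<^sub>0 'k) set" where
  "relators3 scale =
     {fbasis (x + x', y, z) - fbasis (x, y, z) - fbasis (x', y, z) | x x' y z. True} \<union>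
     {fbasis (x, y + y', z) - fbasis (x, y, z) - fbasis (x, y', z) | x y y' z. True} \<union>
     {fbasis (x, y, z + z') - fbasis (x, y, z) - fbasis (x, y, z') | x y z z'. True} \<union>
     {fbasis (scale c x, y, z) - fscale c (fbasis (x, y, z)) | c x y z. True} \<union>
     {fbasis (x, scale c y, z) - fscale c (fbasis (x, y, z)) | c x y z. True} \<union>
     {fbasis (x, y, scale c z) - fscale c (fbasis (x, y, z)) | c x y z. True}"

definition tensor2_rel ::
    "('k::field_char_0 \<Rightarrow> 'a::ring \<Rightarrow> 'a) \<Rightarrow> ((('a \<times> 'a) \<Rightarrow>\<^sub>0 'k) \<times> (('a \<times> 'a) \<Rightarrow>\<^sub>0 'k)) set" where
  "tensor2_rel scale = {(p, q). p - q \<in> free.span (relators2 scale)}"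

definition tensor3_rel ::
    "('k::field_char_0 \<Rightarrow> 'a::ring \<Rightarrow> 'a) \<Rightarrow> ((('a \<times> 'a \<times> 'a) \<Rightarrow>\<^sub>0 'k) \<times> (('a \<times> 'a \<times> 'a) \<Rightarrow>\<^sub>0 'k)) set" where
  "tensor3_rel scale = {(p, q). p - q \<in> free.span (relators3 scale)}"

definition tensor2 :: "('k::field_char_0 \<Rightarrow> 'a::ring \<Rightarrow> 'a) \<Rightarrow> (('a \<times> 'a) \<Rightarrow>\<^sub>0 'k) set set" where
  "tensor2 scale = UNIV // tensor2_rel scale"

definition tensor3_zero :: "('k::field_char_0 \<Rightarrow> 'a::ring \<Rightarrow> 'a) \<Rightarrow> (('a \<times> 'a \<times> 'a) \<Rightarrow>\<^sub>0 'k) set" where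
  "tensor3_zero scale = tensor3_rel scale `` {0}"

lemma equiv_tensor2_rel: "equiv UNIV (tensor2_rel scale)"
proof (rule equivI)
  show "refl (tensor2_rel scale)"
    by (auto simp: refl_on_def tensor2_rel_def free.span_zero)
  show "sym (tensor2_rel scale)"
    by (rule symI) (metis (mono_tags, lifting) case_prodD case_prodI free.span_neg mem_Collect_eq
        minus_diff_eq tensor2_rel_def)
  show "trans (tensor2_rel scale)"
  proof (rule transI)
    fix p q t assume "(p, q) \<in> tensor2_rel scale" "(q, t) \<in> tensor2_rel scale"
    then show "(p, t) \<in> tensor2_rel scale"
      using free.span_add[of "p - q" "relators2 scale" "q - t"] by (simp add: tensor2_rel_def)
  qed
qed auto

lemma equiv_tensor3_rel: "equiv UNIV (tensor3_rel scale)"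
proof (rule equivI)
  show "refl (tensor3_rel scale)"
    by (auto simp: refl_on_def tensor3_rel_def free.span_zero)
  show "sym (tensor3_rel scale)"
    by (rule symI) (metis (mono_tags, lifting) case_prodD case_prodI free.span_neg mem_Collect_eq
        minus_diff_eq tensor3_rel_def)
  show "trans (tensor3_rel scale)"
  proof (rule transI)
    fix p q t assume "(p, q) \<in> tensor3_rel scale" "(q, t) \<in> tensor3_rel scale"
    then show "(p, t) \<in> tensor3_rel scale"
      using free.span_add[of "p - q" "relators3 scale" "q - t"] by (simp add: tensor3_rel_def)
  qed
qed auto

text \<open>
  The value \<open>\<Sum> f a b\<close> at \<open>r = \<Sum> a \<otimes> b\<close> of the linear map on \<open>A \<otimes> A\<close> induced by a
  bilinear map \<open>f\<close>: all representatives of \<open>r\<close> give the same value, which \<open>the_elem\<close> extracts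
  (see \<open>tensor2_lift_eq\<close> below).
\<close>

definition tensor2_lift ::
    "('k::field_char_0 \<Rightarrow> 'v::ab_group_add \<Rightarrow> 'v) \<Rightarrow> ('a \<Rightarrow> 'a \<Rightarrow> 'v) \<Rightarrow> (('a \<times> 'a) \<Rightarrow>\<^sub>0 'k) set \<Rightarrow> 'v" where
  "tensor2_lift s f r = the_elem (lin_ext s (\<lambda>(x, y). f x y) ` r)"

text \<open>
  The map \<open>(A \<otimes> A) \<times> (A \<otimes> A) \<rightarrow> A \<otimes> A \<otimes> A\<close> induced by a map \<open>F\<close> on representatives that
  respects the relations (see \<open>tensor3_of_eq\<close> below).
\<close>

definition tensor3_of ::
    "('k::field_char_0 \<Rightarrow> 'a::ring \<Rightarrow> 'a) \<Rightarrow>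
     ((('a \<times> 'a) \<Rightarrow>\<^sub>0 'k) \<Rightarrow> (('a \<times> 'a) \<Rightarrow>\<^sub>0 'k) \<Rightarrow> (('a \<times> 'a \<times> 'a) \<Rightarrow>\<^sub>0 'k)) \<Rightarrow>
     (('a \<times> 'a) \<Rightarrow>\<^sub>0 'k) set \<Rightarrow> (('a \<times> 'a) \<Rightarrow>\<^sub>0 'k) set \<Rightarrow> (('a \<times> 'a \<times> 'a) \<Rightarrow>\<^sub>0 'k) set" where
  "tensor3_of scale F r s = (\<Union>p\<in>r. \<Union>q\<in>s. tensor3_rel scale `` {F p q})"


section \<open>Associative Yang-Baxter solutions\<close>

text \<open>
  For \<open>r = \<Sum> a \<otimes> b\<close> and \<open>s = \<Sum> c \<otimes> d\<close>, the three maps below represent the products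
  \<open>r\<^sub>1\<^sub>3 s\<^sub>1\<^sub>2\<close>, \<open>r\<^sub>1\<^sub>2 s\<^sub>2\<^sub>3\<close> and \<open>r\<^sub>2\<^sub>3 s\<^sub>1\<^sub>3\<close>.
\<close>

definition prod_13_12 ::
    "(('a::ring \<times> 'a) \<Rightarrow>\<^sub>0 'k::field_char_0) \<Rightarrow> (('a \<times> 'a) \<Rightarrow>\<^sub>0 'k) \<Rightarrow> (('a \<times> 'a \<times> 'a) \<Rightarrow>\<^sub>0 'k)" where
  "prod_13_12 = bilin_ext (\<lambda>(a, b) (c, d). (a * c, d, b))"

definition prod_12_23 ::
    "(('a::ring \<times> 'a) \<Rightarrow>\<^sub>0 'k::field_char_0) \<Rightarrow> (('a \<times> 'a) \<Rightarrow>\<^sub>0 'k) \<Rightarrow> (('a \<times> 'a \<times> 'a) \<Rightarrow>\<^sub>0 'k)" where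
  "prod_12_23 = bilin_ext (\<lambda>(a, b) (c, d). (a, b * c, d))"

definition prod_23_13 ::
    "(('a::ring \<times> 'a) \<Rightarrow>\<^sub>0 'k::field_char_0) \<Rightarrow> (('a \<times> 'a) \<Rightarrow>\<^sub>0 'k) \<Rightarrow> (('a \<times> 'a \<times> 'a) \<Rightarrow>\<^sub>0 'k)" where
  "prod_23_13 = bilin_ext (\<lambda>(a, b) (c, d). (c, a, b * d))"

definition AYB_solution ::
    "('k::field_char_0 \<Rightarrow> 'a::ring \<Rightarrow> 'a) \<Rightarrow> (('a \<times> 'a) \<Rightarrow>\<^sub>0 'k) set \<Rightarrow> bool" where
  "AYB_solution scale r \<longleftrightarrow> r \<in> tensor2 scale \<and>
     tensor3_of scale (\<lambda>p q. prod_13_12 p q - prod_12_23 p q + prod_23_13 p q) r r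
       = tensor3_zero scale"

definition compatible_AYB_solution ::
    "('k::field_char_0 \<Rightarrow> 'a::ring \<Rightarrow> 'a) \<Rightarrow>
     (('a \<times> 'a) \<Rightarrow>\<^sub>0 'k) set \<Rightarrow> (('a \<times> 'a) \<Rightarrow>\<^sub>0 'k) set \<Rightarrow> bool" where
  "compatible_AYB_solution scale r1 r2 \<longleftrightarrow>
     AYB_solution scale r1 \<and> AYB_solution scale r2 \<and>
     tensor3_of scale (\<lambda>p q. prod_13_12 p q + prod_13_12 q p - prod_12_23 p q - prod_12_23 q p
         + prod_23_13 p q + prod_23_13 q p) r1 r2
       = tensor3_zero scale"


section \<open>Independence of representatives\<close>

lemma tensor2_lift_eq:
  fixes scale :: "'k::field_char_0 \<Rightarrow> 'a::ring \<Rightarrow> 'a" and s :: "'k \<Rightarrow> 'v::ab_group_add \<Rightarrow> 'v"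
  assumes V: "vector_space s"
    and add1: "\<And>x x' y. f (x + x') y = f x y + f x' y"
    and add2: "\<And>x y y'. f x (y + y') = f x y + f x y'"
    and sc1: "\<And>c x y. f (scale c x) y = s c (f x y)"
    and sc2: "\<And>c x y. f x (scale c y) = s c (f x y)"
    and r: "r \<in> tensor2 scale" "p \<in> r"
  shows "tensor2_lift s f r = lin_ext s (\<lambda>(x, y). f x y) p"
proof -
  interpret V: vector_space s by (rule V)
  let ?L = "lin_ext s (\<lambda>(x, y). f x y)"
  interpret L: Vector_Spaces.linear fscale s ?L by (rule V.linear_lin_ext)
  have zero: "?L d = 0" if "d \<in> free.span (relators2 scale)" for d
    using that
  proof (rule L.eq_0_on_span[rotated])
    fix d assume "d \<in> relators2 scale"
    then show "?L d = 0"
      unfolding relators2_def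
      by (auto simp: V.lin_ext_diff V.lin_ext_scale add1 add2 sc1 sc2)
  qed
  have "?L q = ?L p" if "q \<in> r" for q
  proof -
    have "(q, p) \<in> tensor2_rel scale"
      using r that quotient_eq_iff[OF equiv_tensor2_rel, of r scale r q p]
      unfolding tensor2_def by blast
    then have "q - p \<in> free.span (relators2 scale)" by (simp add: tensor2_rel_def)
    from zero[OF this] show ?thesis by (simp add: V.lin_ext_diff)
  qed
  then have "?L ` r = {?L p}" using r(2) by blast
  then show ?thesis by (simp add: tensor2_lift_def)
qed

lemma bilin_ext_add_left: "bilin_ext g (p + p') q = bilin_ext g p q + bilin_ext g p' q"
  by (simp add: bilin_ext_def free.lin_ext_add)

lemma bilin_ext_diff_left: "bilin_ext g (p - p') q = bilin_ext g p q - bilin_ext g p' q"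
  by (simp add: bilin_ext_def free.lin_ext_diff)

lemma bilin_ext_scale_left: "bilin_ext g (fscale c p) q = fscale c (bilin_ext g p q)"
  by (simp add: bilin_ext_def free.lin_ext_scale)

lemma bilin_ext_flip: "bilin_ext g p q = bilin_ext (\<lambda>y x. g x y) q p"
  unfolding bilin_ext_def lin_ext_def
  by (simp add: free.scale_sum_right mult.commute sum.swap[of _ "Poly_Mapping.keys p"])

lemma bilin_ext_fbasis_left: "bilin_ext g (fbasis x) q = lin_ext fscale (\<lambda>y. fbasis (g x y)) q"
  by (simp add: bilin_ext_def)

lemma bilin_ext_span_left:
  assumes gen: "\<And>d y. d \<in> R \<Longrightarrow> bilin_ext g d (fbasis y) \<in> free.span S"
    and d: "d \<in> free.span R"
  shows "bilin_ext g d q \<in> free.span S"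
proof -
  have expand: "bilin_ext g d q = (\<Sum>y\<in>Poly_Mapping.keys q. fscale (Poly_Mapping.lookup q y) (bilin_ext g d (fbasis y)))" for d
    unfolding bilin_ext_flip[of g d]
    by (simp add: bilin_ext_fbasis_left) (simp add: bilin_ext_def lin_ext_def)
  have "bilin_ext g d q \<in> free.span S" if "d \<in> R" for d
    unfolding expand using gen[OF that] by (intro free.span_sum free.span_scale)
  then have "R \<subseteq> {d. bilin_ext g d q \<in> free.span S}" by blast
  moreover have "free.subspace {d. bilin_ext g d q \<in> free.span S}"
  proof (rule free.subspaceI)
    show "0 \<in> {d. bilin_ext g d q \<in> free.span S}"
      using free.span_zero by (simp add: bilin_ext_def lin_ext_def)
  qed (auto simp: bilin_ext_add_left bilin_ext_scale_left free.span_add free.span_scale)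
  ultimately show ?thesis using d free.span_minimal by blast
qed

lemma relators3_span:
  fixes scale :: "'k::field_char_0 \<Rightarrow> 'a::ring \<Rightarrow> 'a"
  shows "fbasis (x + x', y, z) - fbasis (x, y, z) - fbasis (x', y, z) \<in> free.span (relators3 scale)"
    and "fbasis (x, y + y', z) - fbasis (x, y, z) - fbasis (x, y', z) \<in> free.span (relators3 scale)"
    and "fbasis (x, y, z + z') - fbasis (x, y, z) - fbasis (x, y, z') \<in> free.span (relators3 scale)"
    and "fbasis (scale c x, y, z) - fscale c (fbasis (x, y, z)) \<in> free.span (relators3 scale)"
    and "fbasis (x, scale c y, z) - fscale c (fbasis (x, y, z)) \<in> free.span (relators3 scale)"
    and "fbasis (x, y, scale c z) - fscale c (fbasis (x, y, z)) \<in> free.span (relators3 scale)"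
proof -
  show "fbasis (x + x', y, z) - fbasis (x, y, z) - fbasis (x', y, z) \<in> free.span (relators3 scale)"
    by (rule free.span_base) (unfold relators3_def Un_iff mem_Collect_eq, fast)
  show "fbasis (x, y + y', z) - fbasis (x, y, z) - fbasis (x, y', z) \<in> free.span (relators3 scale)"
    by (rule free.span_base) (unfold relators3_def Un_iff mem_Collect_eq, fast)
  show "fbasis (x, y, z + z') - fbasis (x, y, z) - fbasis (x, y, z') \<in> free.span (relators3 scale)"
    by (rule free.span_base) (unfold relators3_def Un_iff mem_Collect_eq, fast)
  show "fbasis (scale c x, y, z) - fscale c (fbasis (x, y, z)) \<in> free.span (relators3 scale)"
    by (rule free.span_base) (unfold relators3_def Un_iff mem_Collect_eq, fast)
  show "fbasis (x, scale c y, z) - fscale c (fbasis (x, y, z)) \<in> free.span (relators3 scale)"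
    by (rule free.span_base) (unfold relators3_def Un_iff mem_Collect_eq, fast)
  show "fbasis (x, y, scale c z) - fscale c (fbasis (x, y, z)) \<in> free.span (relators3 scale)"
    by (rule free.span_base) (unfold relators3_def Un_iff mem_Collect_eq, fast)
qed

context assoc_algebra
begin

lemma prod_span:
  assumes "d \<in> free.span (relators2 scale)"
  shows "prod_13_12 d q \<in> free.span (relators3 scale)" "prod_13_12 q d \<in> free.span (relators3 scale)"
    and "prod_12_23 d q \<in> free.span (relators3 scale)" "prod_12_23 q d \<in> free.span (relators3 scale)"
    and "prod_23_13 d q \<in> free.span (relators3 scale)" "prod_23_13 q d \<in> free.span (relators3 scale)"
proof -
  have gen: "bilin_ext g e (fbasis (u, v)) \<in> free.span (relators3 scale)"
    if "e \<in> relators2 scale"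
      and "\<And>x x' y. fbasis (g (x + x', y) (u, v)) - fbasis (g (x, y) (u, v)) - fbasis (g (x', y) (u, v)) \<in> free.span (relators3 scale)"
      and "\<And>x y y'. fbasis (g (x, y + y') (u, v)) - fbasis (g (x, y) (u, v)) - fbasis (g (x, y') (u, v)) \<in> free.span (relators3 scale)"
      and "\<And>c x y. fbasis (g (scale c x, y) (u, v)) - fscale c (fbasis (g (x, y) (u, v))) \<in> free.span (relators3 scale)"
      and "\<And>c x y. fbasis (g (x, scale c y) (u, v)) - fscale c (fbasis (g (x, y) (u, v))) \<in> free.span (relators3 scale)"
    for g :: "'a \<times> 'a \<Rightarrow> 'a \<times> 'a \<Rightarrow> 'a \<times> 'a \<times> 'a" and e u v
    using that(1) unfolding relators2_def
    by (auto simp: bilin_ext_diff_left bilin_ext_scale_left bilin_ext_fbasis_left free.lin_ext_fbasis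
        intro: that(2-5))
  note [simp] = distrib_left distrib_right scale_mult_left scale_mult_right relators3_span
  show "prod_13_12 d q \<in> free.span (relators3 scale)"
    unfolding prod_13_12_def
    by (rule bilin_ext_span_left[OF _ assms], case_tac y, simp only:, rule gen) simp_all
  show "prod_13_12 q d \<in> free.span (relators3 scale)"
    unfolding prod_13_12_def bilin_ext_flip[of _ q d]
    by (rule bilin_ext_span_left[OF _ assms], case_tac y, simp only:, rule gen) simp_all
  show "prod_12_23 d q \<in> free.span (relators3 scale)"
    unfolding prod_12_23_def
    by (rule bilin_ext_span_left[OF _ assms], case_tac y, simp only:, rule gen) simp_all
  show "prod_12_23 q d \<in> free.span (relators3 scale)"
    unfolding prod_12_23_def bilin_ext_flip[of _ q d]
    by (rule bilin_ext_span_left[OF _ assms], case_tac y, simp only:, rule gen) simp_all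
  show "prod_23_13 d q \<in> free.span (relators3 scale)"
    unfolding prod_23_13_def
    by (rule bilin_ext_span_left[OF _ assms], case_tac y, simp only:, rule gen) simp_all
  show "prod_23_13 q d \<in> free.span (relators3 scale)"
    unfolding prod_23_13_def bilin_ext_flip[of _ q d]
    by (rule bilin_ext_span_left[OF _ assms], case_tac y, simp only:, rule gen) simp_all
qed

lemma prod_congruent:
  assumes pp: "(p, p') \<in> tensor2_rel scale" and qq: "(q, q') \<in> tensor2_rel scale"
  shows "(prod_13_12 p q, prod_13_12 p' q') \<in> tensor3_rel scale"
    and "(prod_12_23 p q, prod_12_23 p' q') \<in> tensor3_rel scale"
    and "(prod_23_13 p q, prod_23_13 p' q') \<in> tensor3_rel scale"
proof -
  have split: "bilin_ext g p q - bilin_ext g p' q' = bilin_ext g (p - p') q + bilin_ext g p' (q - q')" for g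
    by (simp add: bilin_ext_diff_left bilin_ext_flip[of g p' "q - q'"] bilin_ext_flip[of g p' q]
        bilin_ext_flip[of g p' q'])
  show "(prod_13_12 p q, prod_13_12 p' q') \<in> tensor3_rel scale"
       "(prod_12_23 p q, prod_12_23 p' q') \<in> tensor3_rel scale"
       "(prod_23_13 p q, prod_23_13 p' q') \<in> tensor3_rel scale"
    using pp qq prod_span[of "p - p'" q] prod_span[of "q - q'" p']
    unfolding tensor2_rel_def tensor3_rel_def
    by (simp_all add: split prod_13_12_def prod_12_23_def prod_23_13_def free.span_add)
qed

lemma tensor3_rel_add:
  "(u, u') \<in> tensor3_rel scale \<Longrightarrow> (v, v') \<in> tensor3_rel scale \<Longrightarrow> (u + v, u' + v') \<in> tensor3_rel scale"
  unfolding tensor3_rel_def by (auto dest: free.span_add simp: algebra_simps)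

lemma tensor3_rel_diff:
  "(u, u') \<in> tensor3_rel scale \<Longrightarrow> (v, v') \<in> tensor3_rel scale \<Longrightarrow> (u - v, u' - v') \<in> tensor3_rel scale"
  unfolding tensor3_rel_def by (auto dest: free.span_diff simp: algebra_simps)

lemma tensor3_of_eq:
  assumes F: "congruent2 (tensor2_rel scale) (tensor2_rel scale) (\<lambda>p q. tensor3_rel scale `` {F p q})"
    and r: "r \<in> tensor2 scale" "p \<in> r" and s: "s \<in> tensor2 scale" "q \<in> s"
  shows "tensor3_of scale F r s = tensor3_rel scale `` {F p q}"
proof -
  have cls: "t = tensor2_rel scale `` {u}" if "t \<in> tensor2 scale" "u \<in> t" for t u
  proof -
    from that(1) obtain v where v: "t = tensor2_rel scale `` {v}"
      unfolding tensor2_def by (rule quotientE)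
    with that(2) have "(v, u) \<in> tensor2_rel scale" by simp
    then show ?thesis unfolding v by (rule equiv_class_eq[OF equiv_tensor2_rel])
  qed
  have "r = tensor2_rel scale `` {p}" "s = tensor2_rel scale `` {q}"
    using cls r s by blast+
  then show ?thesis
    unfolding tensor3_of_def
    using UN_equiv_class2[OF equiv_tensor2_rel equiv_tensor2_rel F] by simp
qed

lemma tensor3_rel_zero_iff:
  "tensor3_rel scale `` {u} = tensor3_zero scale \<longleftrightarrow> u \<in> free.span (relators3 scale)"
  using eq_equiv_class_iff[OF equiv_tensor3_rel, of u 0 scale]
  by (simp add: tensor3_zero_def tensor3_rel_def)

text \<open>The solution conditions may be tested on any representatives.\<close>

lemma AYB_solution_iff:
  assumes "r \<in> tensor2 scale" "p \<in> r" "q \<in> r"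
  shows "AYB_solution scale r \<longleftrightarrow>
    prod_13_12 p q - prod_12_23 p q + prod_23_13 p q \<in> free.span (relators3 scale)"
proof -
  have "congruent2 (tensor2_rel scale) (tensor2_rel scale)
    (\<lambda>p q. tensor3_rel scale `` {prod_13_12 p q - prod_12_23 p q + prod_23_13 p q})"
    by (intro congruent2I' equiv_class_eq[OF equiv_tensor3_rel] tensor3_rel_add tensor3_rel_diff prod_congruent)
  from tensor3_of_eq[OF this assms(1,2) assms(1,3)] show ?thesis
    using assms(1) by (simp add: AYB_solution_def tensor3_rel_zero_iff)
qed

lemma compatible_AYB_solution_iff:
  assumes "r1 \<in> tensor2 scale" "p \<in> r1" "r2 \<in> tensor2 scale" "q \<in> r2"
  shows "compatible_AYB_solution scale r1 r2 \<longleftrightarrow> AYB_solution scale r1 \<and> AYB_solution scale r2 \<and>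
    prod_13_12 p q + prod_13_12 q p - prod_12_23 p q - prod_12_23 q p
      + prod_23_13 p q + prod_23_13 q p \<in> free.span (relators3 scale)"
proof -
  have "congruent2 (tensor2_rel scale) (tensor2_rel scale)
    (\<lambda>p q. tensor3_rel scale `` {prod_13_12 p q + prod_13_12 q p - prod_12_23 p q - prod_12_23 q p
      + prod_23_13 p q + prod_23_13 q p})"
    by (intro congruent2I' equiv_class_eq[OF equiv_tensor3_rel] tensor3_rel_add tensor3_rel_diff prod_congruent)
  from tensor3_of_eq[OF this assms] show ?thesis
    by (simp add: compatible_AYB_solution_def tensor3_rel_zero_iff)
qed

end

end

theory Submission
  imports Defs
begin

text \<open>
  For fixed \<open>u, v \<in> A\<close> the trilinear map \<open>x \<otimes> y \<otimes> z \<mapsto> x u y v z\<close> induces a linear map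
  from \<open>A \<otimes> A \<otimes> A\<close> to \<open>A\<close>: it fills the two gaps of a tensor with \<open>u\<close> and \<open>v\<close>.
  Write \<open>T\<^sub>p(u) = \<Sum> a u b\<close> for \<open>p = \<Sum> a \<otimes> b\<close>. Filling the gaps of the three products that occur in
  the Yang-Baxter equation gives
    \<open>p\<^sub>1\<^sub>3 q\<^sub>1\<^sub>2 \<mapsto> T\<^sub>p(T\<^sub>q(u) v)\<close>,
    \<open>p\<^sub>1\<^sub>2 q\<^sub>2\<^sub>3 \<mapsto> T\<^sub>p(u) T\<^sub>q(v)\<close>,
    \<open>p\<^sub>2\<^sub>3 q\<^sub>1\<^sub>3 \<mapsto> T\<^sub>q(u T\<^sub>p(v))\<close>
  (lemmas \<open>fill_gaps_prod_13_12\<close>, \<open>fill_gaps_prod_12_23\<close> and \<open>fill_gaps_prod_23_13\<close>). Hence the image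
  of the Yang-Baxter equation for \<open>p = q\<close> is the Rota-Baxter identity of \<open>T\<^sub>p\<close>, and the image
  of the mixed equation is the compatibility condition for \<open>T\<^sub>p\<close> and \<open>T\<^sub>q\<close>.

  The calculations are made with formal combinations \<open>p\<close> and \<open>q\<close> that represent the tensors. Passing
  to the tensor product costs only the remark that the map vanishes on the
  multilinearity relators (\<open>fill_gaps_eq_0\<close>).
\<close>

lemma linear_lin_ext_commute:
  assumes "Vector_Spaces.linear s t L"
  shows "L (lin_ext s h p) = lin_ext t (\<lambda>x. L (h x)) p"
proof -
  interpret L: Vector_Spaces.linear s t L by (rule assms)
  show ?thesis by (simp add: lin_ext_def L.sum L.scale)
qed

lemma (in vector_space) lin_ext_bilin_ext:
  "lin_ext scale h (bilin_ext g p q) = lin_ext scale (\<lambda>x. lin_ext scale (\<lambda>y. h (g x y)) q) p"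
  unfolding bilin_ext_def by (simp add: linear_lin_ext_commute[OF linear_lin_ext])

context assoc_algebra
begin

definition sandwich :: "(('a \<times> 'a) \<Rightarrow>\<^sub>0 'k) \<Rightarrow> 'a \<Rightarrow> 'a" where
  "sandwich p u = lin_ext scale (\<lambda>(x, y). x * u * y) p"

definition fill_gaps :: "'a \<Rightarrow> 'a \<Rightarrow> (('a \<times> 'a \<times> 'a) \<Rightarrow>\<^sub>0 'k) \<Rightarrow> 'a" where
  "fill_gaps u v = lin_ext scale (\<lambda>(x, y, z). x * u * y * v * z)"

lemma fill_gaps_add: "fill_gaps u v (w + w') = fill_gaps u v w + fill_gaps u v w'"
  by (simp add: fill_gaps_def lin_ext_add)

lemma fill_gaps_diff: "fill_gaps u v (w - w') = fill_gaps u v w - fill_gaps u v w'"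
  by (simp add: fill_gaps_def lin_ext_diff)

lemma linear_mult_left: "Vector_Spaces.linear scale scale (\<lambda>z. x * z)"
  by unfold_locales (simp_all add: distrib_left scale_mult_right)

lemma linear_mult_both: "Vector_Spaces.linear scale scale (\<lambda>z. x * z * y)"
  by unfold_locales (simp_all add: distrib_left distrib_right scale_mult_left scale_mult_right)

lemma linear_sandwich: "Vector_Spaces.linear scale scale (sandwich p)"
proof unfold_locales
  show "sandwich p (u + v) = sandwich p u + sandwich p v" for u v
    by (simp add: sandwich_def lin_ext_def case_prod_unfold distrib_left distrib_right
        scale_right_distrib sum.distrib)
  show "sandwich p (scale c u) = scale c (sandwich p u)" for c u
    by (simp add: sandwich_def lin_ext_def case_prod_unfold scale_mult_left scale_mult_right
        scale_sum_right mult.commute)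
qed

lemma tensor2_lift_sandwich:
  assumes "r \<in> tensor2 scale" "p \<in> r"
  shows "tensor2_lift scale (\<lambda>x y. x * u * y) r = sandwich p u"
  unfolding sandwich_def
  by (rule tensor2_lift_eq[where scale = scale, OF vector_space_axioms])
    (simp_all add: assms distrib_left distrib_right scale_mult_left scale_mult_right)

text \<open>The product \<open>x u y v z\<close> is linear in each of \<open>x, y, z\<close>, so \<open>fill_gaps\<close> descends to \<open>A \<otimes> A \<otimes> A\<close>.\<close>

lemma fill_gaps_eq_0:
  assumes "w \<in> free.span (relators3 scale)"
  shows "fill_gaps u v w = 0"
proof -
  interpret L: Vector_Spaces.linear fscale scale "fill_gaps u v"
    unfolding fill_gaps_def by (rule linear_lin_ext)
  show ?thesis
    using assms
  proof (rule L.eq_0_on_span[rotated])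
    fix d assume "d \<in> relators3 scale"
    then show "fill_gaps u v d = 0"
      unfolding relators3_def fill_gaps_def
      by (auto simp: lin_ext_diff lin_ext_scale distrib_left distrib_right
          scale_mult_left scale_mult_right)
  qed
qed

text \<open>
  In \<open>\<Sum> a c \<otimes> d \<otimes> b\<close> the second tensor \<open>c \<otimes> d\<close> encloses the first gap only, and \<open>a \<otimes> b\<close>
  encloses everything, so the two sandwich maps become nested: \<open>a (c u d) v b\<close>.
\<close>

lemma fill_gaps_prod_13_12: "fill_gaps u v (prod_13_12 p q) = sandwich p (sandwich q u * v)"
proof -
  have inner: "lin_ext scale (\<lambda>(c, d). a * c * u * d * v * b) q = a * (sandwich q u * v) * b" for a b
    using linear_lin_ext_commute[OF linear_mult_both[of a "v * b"], of "\<lambda>(c, d). c * u * d" q]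
    by (simp add: sandwich_def case_prod_unfold mult.assoc)
  show ?thesis
    unfolding fill_gaps_def prod_13_12_def lin_ext_bilin_ext sandwich_def[of p]
    by (simp add: case_prod_unfold inner[unfolded case_prod_unfold])
qed

text \<open>In \<open>\<Sum> a \<otimes> b c \<otimes> d\<close> each tensor encloses one gap, so the sandwich maps stand side by side.\<close>

lemma fill_gaps_prod_12_23: "fill_gaps u v (prod_12_23 p q) = sandwich p u * sandwich q v"
proof -
  have inner: "lin_ext scale (\<lambda>(c, d). a * u * (b * c) * v * d) q = a * u * b * sandwich q v" for a b
    using linear_lin_ext_commute[OF linear_mult_left[of "a * u * b"], of "\<lambda>(c, d). c * v * d" q]
    by (simp add: sandwich_def case_prod_unfold mult.assoc)
  have "Vector_Spaces.linear scale scale (\<lambda>z. z * sandwich q v)"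
    by unfold_locales (simp_all add: distrib_right scale_mult_left)
  from linear_lin_ext_commute[OF this, of "\<lambda>(a, b). a * u * b" p] show ?thesis
    unfolding fill_gaps_def prod_12_23_def lin_ext_bilin_ext sandwich_def[of p]
    by (simp add: case_prod_unfold inner[unfolded case_prod_unfold])
qed

text \<open>Mirror image of the nested case: now \<open>a \<otimes> b\<close> encloses the second gap and \<open>c \<otimes> d\<close> everything.\<close>

lemma fill_gaps_prod_23_13: "fill_gaps u v (prod_23_13 p q) = sandwich q (u * sandwich p v)"
proof -
  have inner: "lin_ext scale (\<lambda>(a, b). c * u * a * v * (b * d)) p = c * (u * sandwich p v) * d" for c d
    using linear_lin_ext_commute[OF linear_mult_both[of "c * u" d], of "\<lambda>(a, b). a * v * b" p]
    by (simp add: sandwich_def case_prod_unfold mult.assoc)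
  \<comment> \<open>The outer tensor is the second factor here, so the order of summation is exchanged.\<close>
  show ?thesis
    unfolding fill_gaps_def prod_23_13_def bilin_ext_flip[of _ p q] lin_ext_bilin_ext sandwich_def[of q]
    by (simp add: case_prod_unfold inner[unfolded case_prod_unfold])
qed

lemmas fill_gaps_simps = fill_gaps_add fill_gaps_diff
  fill_gaps_prod_13_12 fill_gaps_prod_12_23 fill_gaps_prod_23_13

lemma sandwich_add: "sandwich p (u + v) = sandwich p u + sandwich p v"
proof -
  interpret L: Vector_Spaces.linear scale scale "sandwich p" by (rule linear_sandwich)
  show ?thesis by (rule L.add)
qed

lemma AYB_solution_imp_Rota_Baxter:
  assumes "AYB_solution scale r" "p \<in> r"
  shows "O_operator scale scale (*) (*) (sandwich p)"
proof -
  interpret adj: algebra_bimodule scale scale "(*)" "(*)" by (rule adjoint_bimodule)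
  have "r \<in> tensor2 scale" using assms(1) by (simp add: AYB_solution_def)
  then have "prod_13_12 p p - prod_12_23 p p + prod_23_13 p p \<in> free.span (relators3 scale)"
    using AYB_solution_iff assms by blast
  from fill_gaps_eq_0[OF this]
  have "sandwich p u * sandwich p v = sandwich p (sandwich p u * v + u * sandwich p v)" for u v
    by (simp add: fill_gaps_simps sandwich_add algebra_simps)
  with linear_sandwich show ?thesis
    by (intro O_operator.intro O_operator_axioms.intro adj.algebra_bimodule_axioms)
qed

lemma compatible_AYB_solution_imp_compatible_Rota_Baxter:
  assumes "compatible_AYB_solution scale r1 r2" "p \<in> r1" "q \<in> r2"
  shows "compatible_Rota_Baxter_operator scale (sandwich p) (sandwich q)"
proof -
  have sol: "AYB_solution scale r1" "AYB_solution scale r2"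
    using assms(1) by (simp_all add: compatible_AYB_solution_def)
  then have "r1 \<in> tensor2 scale" "r2 \<in> tensor2 scale"
    by (simp_all add: AYB_solution_def)
  then have "prod_13_12 p q + prod_13_12 q p - prod_12_23 p q - prod_12_23 q p
      + prod_23_13 p q + prod_23_13 q p \<in> free.span (relators3 scale)"
    using compatible_AYB_solution_iff assms by blast
  from fill_gaps_eq_0[OF this]
  have "sandwich p u * sandwich q v + sandwich q u * sandwich p v =
      sandwich p (sandwich q u * v + u * sandwich q v)
      + sandwich q (sandwich p u * v + u * sandwich p v)" for u v
    by (simp add: fill_gaps_simps sandwich_add algebra_simps)
  then show ?thesis
    unfolding compatible_Rota_Baxter_operator_def
    by (intro compatible_O_operator.intro compatible_O_operator_axioms.intro
        AYB_solution_imp_Rota_Baxter[OF sol(1) assms(2)]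
        AYB_solution_imp_Rota_Baxter[OF sol(2) assms(3)])
qed

end

theorem proposition2p9:
  fixes scale :: "'k::field_char_0 \<Rightarrow> 'a::ring \<Rightarrow> 'a"
    and r1 r2 :: "(('a \<times> 'a) \<Rightarrow>\<^sub>0 'k) set"
    and T1 T2 :: "'a \<Rightarrow> 'a"
  assumes "assoc_algebra scale"
    and "compatible_AYB_solution scale r1 r2"
    and "\<And>a. T1 a = tensor2_lift scale (\<lambda>x y. x * a * y) r1"
    and "\<And>a. T2 a = tensor2_lift scale (\<lambda>x y. x * a * y) r2"
  shows "compatible_Rota_Baxter_operator scale T1 T2"
proof -
  interpret assoc_algebra scale by (rule assms(1))
  have r: "r1 \<in> tensor2 scale" "r2 \<in> tensor2 scale"
    using assms(2) by (simp_all add: compatible_AYB_solution_def AYB_solution_def)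
  \<comment> \<open>Tensors are equivalence classes, hence nonempty, so representatives exist.\<close>
  obtain p q where pq: "p \<in> r1" "q \<in> r2"
    using r in_quotient_imp_non_empty[OF equiv_tensor2_rel] unfolding tensor2_def by blast
  have "T1 = sandwich p" "T2 = sandwich q"
    by (simp_all add: fun_eq_iff assms(3,4) tensor2_lift_sandwich r pq)
  with compatible_AYB_solution_imp_compatible_Rota_Baxter[OF assms(2) pq] show ?thesis
    by simp
qed

end
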